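(* Let $S$ be an almost integral semiring and $n\geq 2$ an integer. The following are equivalent: (i) $\mathbf{M}_n(S)$ is subdirectly irreducible. (ii) $S$ is subdirectly irreducible and for all $a,b\in S$ with $a\neq b$ there are $c,d\in S$ such that $cad\neq cbd$. (iii) $S$ has a zero element $0\in S$ and a least non-zero element $e\in S$ (i.e. $e\neq 0$ and $e\leq x$ for every $x\in S\setminus\{0\}$). Also, for all $a,b\in S$ with $a\not\leq b$ there are $c,d\in S$ such that $cad\neq 0=cbd$.
   Context: A semiring $S(+,\cdot)$ is a non-empty set with two associative binary operations such that $+$ is commutative and $\cdot$ distributes over $+$ from both sides (no zero or unity is required). It is additively idempotent if $a+a=a$ for all $a\in S$; then $S$ is ordered by $a\leq b$ iff $a+b=b$. $S$ is almost integral if it is additively idempotent and $ab\leq a$ and $ba\leq a$ for all $a,b\in S$. A zero is an element $0$ with $a0=0=0a$ and $a+0=a$ for all $a\in S$. A congruence on $S$ is an equivalence relation preserved under addition and multiplication. $S$ is subdirectly irreducible if there is a least (with respect to inclusion) congruence among the congruences of $S$ different from the identity relation $id_S$; in particular at least one such congruence exists. $\mathbf{M}_n(S)$ is the semiring of all $n\times n$ matrices over $S$ with the usual addition and multiplication: $(a_{ij})+(b_{ij})=(a_{ij}+b_{ij})$, $(a_{ij})(b_{ij})=(\sum_k a_{ik}b_{kj})$. *)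

theory Defs
  imports "HOL-Analysis.Finite_Cartesian_Product"
begin

(* The library class semiring requires neither a zero nor a unity. *)

class additively_idempotent_semiring = semiring + ord +
  assumes add_idem: "a + a = a"
    and less_eq_iff_add: "a \<le> b \<longleftrightarrow> a + b = b"
    and less_iff_le_not_le: "a < b \<longleftrightarrow> a \<le> b \<and> \<not> b \<le> a"
begin

subclass order
proof
  fix x y z :: 'a
  show "x < y \<longleftrightarrow> x \<le> y \<and> \<not> y \<le> x"
    by (rule less_iff_le_not_le)
  show "x \<le> x"
    by (simp add: less_eq_iff_add add_idem)
  show "x \<le> z" if "x \<le> y" "y \<le> z"
    using that unfolding less_eq_iff_add by (metis add_assoc)
  show "x = y" if "x \<le> y" "y \<le> x"
    using that unfolding less_eq_iff_add by (metis add_commute)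
qed

end

class almost_integral_semiring = additively_idempotent_semiring +
  assumes mult_le_left: "a * b \<le> a"
    and mult_le_right: "b * a \<le> a"

definition is_zero :: "'a::semiring \<Rightarrow> bool" where
  "is_zero z \<longleftrightarrow> (\<forall>a. a * z = z \<and> z * a = z \<and> a + z = a)"

(* Congruences and subdirect irreducibility take the two operations as arguments, since
   the type of matrices already carries an unrelated componentwise multiplication. *)

definition congruence ::
  "('a \<Rightarrow> 'a \<Rightarrow> 'a) \<Rightarrow> ('a \<Rightarrow> 'a \<Rightarrow> 'a) \<Rightarrow> 'a rel \<Rightarrow> bool" where
  "congruence add mul R \<longleftrightarrow> equiv UNIV R \<and>
     (\<forall>a b c d. (a, b) \<in> R \<longrightarrow> (c, d) \<in> R \<longrightarrow>
        (add a c, add b d) \<in> R \<and> (mul a c, mul b d) \<in> R)"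

definition subdirectly_irreducible ::
  "('a \<Rightarrow> 'a \<Rightarrow> 'a) \<Rightarrow> ('a \<Rightarrow> 'a \<Rightarrow> 'a) \<Rightarrow> bool" where
  "subdirectly_irreducible add mul \<longleftrightarrow>
     (\<exists>M. congruence add mul M \<and> M \<noteq> Id \<and>
        (\<forall>R. congruence add mul R \<longrightarrow> R \<noteq> Id \<longrightarrow> M \<subseteq> R))"

(* The library sum needs a neutral element for the empty sum; here None plays the role of
   the empty sum, and only sums over nonempty finite index sets are meaningful. *)

definition add_option :: "'a::ab_semigroup_add \<Rightarrow> 'a option \<Rightarrow> 'a option" where
  "add_option x s = Some (case s of None \<Rightarrow> x | Some t \<Rightarrow> x + t)"

definition nonempty_sum :: "('i \<Rightarrow> 'a::ab_semigroup_add) \<Rightarrow> 'i set \<Rightarrow> 'a" where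
  "nonempty_sum f A = the (Finite_Set.fold (\<lambda>i. add_option (f i)) None A)"

interpretation add_option: comp_fun_commute "\<lambda>i. add_option (f i :: 'a::ab_semigroup_add)"
  for f
  by standard (auto simp: add_option_def fun_eq_iff add_ac split: option.split)

lemma nonempty_sum_singleton: "nonempty_sum f {i} = f i"
  by (simp add: nonempty_sum_def add_option_def)

lemma nonempty_sum_insert:
  assumes "finite A" "A \<noteq> {}" "i \<notin> A"
  shows "nonempty_sum f (insert i A) = f i + nonempty_sum f A"
proof -
  obtain j B where "A = insert j B" "j \<notin> B" "finite B"
    using assms by (metis all_not_in_conv finite_insert mk_disjoint_insert)
  then obtain t where "Finite_Set.fold (\<lambda>i. add_option (f i)) None A = Some t"
    by (simp add: add_option_def)
  with assms show ?thesis
    by (simp add: nonempty_sum_def add_option_def)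
qed

lemma nonempty_sum_eq_sum:
  fixes f :: "'i \<Rightarrow> 'a::comm_monoid_add"
  assumes "finite A" "A \<noteq> {}"
  shows "nonempty_sum f A = sum f A"
  using assms
  by (induction rule: finite_ne_induct) (simp_all add: nonempty_sum_singleton nonempty_sum_insert)

definition matrix_mult ::
  "'a::semiring ^ 'n ^ 'n \<Rightarrow> 'a ^ 'n ^ 'n \<Rightarrow> 'a ^ 'n ^ 'n" where
  "matrix_mult A B = (\<chi> i j. nonempty_sum (\<lambda>k. A $ i $ k * B $ k $ j) UNIV)"

lemma matrix_mult_eq_matrix_matrix_mult:
  fixes A B :: "'a::semiring_1 ^ 'n ^ 'n"
  shows "matrix_mult A B = A ** B"
  by (simp add: matrix_mult_def matrix_matrix_mult_def nonempty_sum_eq_sum)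

end

theory Submission
  imports Defs
begin

text \<open>
  If the congruences \<open>R i j\<close> on \<open>S\<close> are multiplicatively compatible like matrix units, then
  requiring entries \<open>(i, j)\<close> to be \<open>R i j\<close>-related is a congruence on the matrix semiring. The
  constant family transfers the monolith of \<open>M\<^sub>n(S)\<close> to \<open>S\<close>. If some \<open>a \<noteq> b\<close> satisfied
  \<open>c a = c b\<close> for all \<open>c\<close>, then relating only the entries of one row would, for two different
  rows, give non-identity congruences with identity intersection; likewise for columns. Hence (i)
  implies (ii).

  Given (ii), the syntactic congruences of the principal down-sets intersect in the identity, so
  one of them is the identity. As almost integrality collapses the down-set to a point, that
  point is the zero, and the congruences \<open>a + s = b + s\<close> with \<open>s \<noteq> 0\<close> yield the least non-zero
  element. Finally, under (iii) multiplication by matrix units moves every non-identity congruence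
  of \<open>M\<^sub>n(S)\<close> down to the pair of the zero matrix and \<open>e\<close> times a matrix unit.
\<close>

section \<open>Congruences and monoliths\<close>

lemma congruenceD:
  assumes "congruence add mul R"
  shows congruence_refl: "(a, a) \<in> R"
    and congruence_sym: "(a, b) \<in> R \<Longrightarrow> (b, a) \<in> R"
    and congruence_trans: "(a, b) \<in> R \<Longrightarrow> (b, c) \<in> R \<Longrightarrow> (a, c) \<in> R"
    and congruence_add: "(a, b) \<in> R \<Longrightarrow> (c, d) \<in> R \<Longrightarrow> (add a c, add b d) \<in> R"
    and congruence_mul: "(a, b) \<in> R \<Longrightarrow> (c, d) \<in> R \<Longrightarrow> (mul a c, mul b d) \<in> R"
  using assms unfolding congruence_def equiv_def
  by (auto dest: refl_onD symD transD)

lemma congruenceI: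
  assumes "\<And>a. (a, a) \<in> R"
    and "\<And>a b. (a, b) \<in> R \<Longrightarrow> (b, a) \<in> R"
    and "\<And>a b c. (a, b) \<in> R \<Longrightarrow> (b, c) \<in> R \<Longrightarrow> (a, c) \<in> R"
    and "\<And>a b c d. (a, b) \<in> R \<Longrightarrow> (c, d) \<in> R \<Longrightarrow> (add a c, add b d) \<in> R"
    and "\<And>a b c d. (a, b) \<in> R \<Longrightarrow> (c, d) \<in> R \<Longrightarrow> (mul a c, mul b d) \<in> R"
  shows "congruence add mul R"
proof -
  have "refl R" "sym R" "trans R"
    using assms(1) by (auto intro: refl_onI symI[OF assms(2)] transI[OF assms(3)])
  then show ?thesis
    unfolding congruence_def equiv_def by (simp add: assms(4,5))
qed

text \<open>Any pair of distinct elements in the monolith witnesses the right-hand side. Conversely,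
  such a pair keeps the intersection of all non-identity congruences from being the identity, so
  this intersection is the monolith.\<close>

lemma subdirectly_irreducible_iff:
  "subdirectly_irreducible add mul \<longleftrightarrow>
     (\<exists>a b. a \<noteq> b \<and> (\<forall>R. congruence add mul R \<longrightarrow> R \<noteq> Id \<longrightarrow> (a, b) \<in> R))"
  (is "_ \<longleftrightarrow> ?pair")
proof
  assume "subdirectly_irreducible add mul"
  then obtain M where M: "congruence add mul M" "M \<noteq> Id"
    and least: "\<And>R. congruence add mul R \<Longrightarrow> R \<noteq> Id \<Longrightarrow> M \<subseteq> R"
    unfolding subdirectly_irreducible_def by blast
  from M obtain a b where "(a, b) \<in> M" "a \<noteq> b"
    using congruence_refl[OF M(1)] by auto
  with least show ?pair by blast
next
  assume ?pair
  then obtain a b where "a \<noteq> b"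
    and ab: "\<And>R. congruence add mul R \<Longrightarrow> R \<noteq> Id \<Longrightarrow> (a, b) \<in> R"
    by blast
  let ?M = "\<Inter> {R. congruence add mul R \<and> R \<noteq> Id}"
  have "congruence add mul ?M"
    by (rule congruenceI)
      (blast intro: congruence_refl congruence_sym congruence_trans congruence_add congruence_mul)+
  moreover have "?M \<noteq> Id"
    using \<open>a \<noteq> b\<close> ab by blast
  ultimately show "subdirectly_irreducible add mul"
    unfolding subdirectly_irreducible_def by blast
qed

text \<open>If every \<open>R i\<close> differed from \<open>Id\<close>, all of them would contain a
  common pair of distinct elements, although they jointly separate points.\<close>

lemma subdirectly_irreducible_family:
  assumes "subdirectly_irreducible add mul"
    and "\<And>i. congruence add mul (R i)"
    and "\<And>a b. (\<And>i. (a, b) \<in> R i) \<Longrightarrow> a = b"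
  obtains i where "R i = Id"
proof -
  obtain a b where "a \<noteq> b" and ab: "\<And>R. congruence add mul R \<Longrightarrow> R \<noteq> Id \<Longrightarrow> (a, b) \<in> R"
    using assms(1) unfolding subdirectly_irreducible_iff by blast
  from assms(3)[of a b] \<open>a \<noteq> b\<close> obtain i where "(a, b) \<notin> R i" by blast
  with ab[OF assms(2), of i] have "R i = Id" by blast
  then show thesis by (rule that)
qed

section \<open>Congruences on ordered semirings and the least non-zero element\<close>

text \<open>Almost integrality lets \<open>s\<close> absorb every multiple of itself, so
  \<open>(x + s) * (y + s) + s = x * y + s\<close>. Hence \<open>x * y + s\<close> depends only on
  \<open>x + s\<close> and \<open>y + s\<close>.\<close>

lemma congruence_add_eq:
  fixes s :: "'a::almost_integral_semiring"
  shows "congruence (+) (*) {(a, b). a + s = b + s}"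
proof (rule congruenceI; clarsimp)
  fix a b c d :: 'a
  assume ab: "a + s = b + s" and cd: "c + s = d + s"
  show "a + c + s = b + d + s"
  proof -
    have "a + c + s = a + (c + s)" by (simp add: add.assoc)
    also have "\<dots> = (a + s) + d" unfolding cd by (simp add: add_ac)
    also have "\<dots> = b + d + s" unfolding ab by (simp add: add_ac)
    finally show ?thesis .
  qed
  have "x * s + s = s" "s * x + s = s" for x
    using mult_le_left[of s x] mult_le_right[of x s] by (simp_all add: less_eq_iff_add)
  then have expand: "(x + s) * (y + s) + s = x * y + s" for x y
    by (simp add: distrib_left distrib_right add.assoc)
  show "a * c + s = b * d + s"
    using expand[of a c] expand[of b d] ab cd by simp
qed

lemma plus_le_iff:
  fixes a b c :: "'a::additively_idempotent_semiring"
  shows "a + b \<le> c \<longleftrightarrow> a \<le> c \<and> b \<le> c"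
  unfolding less_eq_iff_add by (metis add.assoc add.commute add_idem)

text \<open>This is the syntactic congruence of the down-set of \<open>x\<close>. It respects sums
  because a sum lies below \<open>x\<close> iff both summands do, and products because one factor
  can be moved into the context of the other.\<close>

lemma congruence_syntactic:
  fixes x :: "'a::additively_idempotent_semiring"
  shows "congruence (+) (*) {(a, b). \<forall>c d. c * a * d \<le> x \<longleftrightarrow> c * b * d \<le> x}"
proof (rule congruenceI; clarsimp)
  fix a b a' b' c d :: 'a
  assume ab: "\<forall>c d. c * a * d \<le> x \<longleftrightarrow> c * b * d \<le> x"
    and ab': "\<forall>c d. c * a' * d \<le> x \<longleftrightarrow> c * b' * d \<le> x"
  show "c * (a + a') * d \<le> x \<longleftrightarrow> c * (b + b') * d \<le> x"
    using ab ab' by (simp add: distrib_left distrib_right plus_le_iff)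
  have "c * (a * a') * d \<le> x \<longleftrightarrow> c * b * (a' * d) \<le> x"
    using ab by (metis mult.assoc)
  also have "\<dots> \<longleftrightarrow> c * (b * b') * d \<le> x"
    using ab' by (metis mult.assoc)
  finally show "c * (a * a') * d \<le> x \<longleftrightarrow> c * (b * b') * d \<le> x" .
qed

lemma is_zero_if_minimal:
  fixes x :: "'a::almost_integral_semiring"
  assumes "\<And>y. y \<le> x \<Longrightarrow> y = x"
  shows "is_zero x"
proof -
  have "x * a = x" "a * x = x" for a
    using assms mult_le_left mult_le_right by blast+
  moreover from this have "a + x = a" for a
    using mult_le_left[of a x] by (simp add: less_eq_iff_add add.commute)
  ultimately show ?thesis by (simp add: is_zero_def)
qed

lemma least_nonzero_if_subdirectly_irreducible:
  assumes si: "subdirectly_irreducible ((+) :: 'a::almost_integral_semiring \<Rightarrow> 'a \<Rightarrow> 'a) (*)"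
    and sep: "\<And>a b :: 'a. a \<noteq> b \<Longrightarrow> \<exists>c d. c * a * d \<noteq> c * b * d"
  shows "\<exists>z e :: 'a. is_zero z \<and> e \<noteq> z \<and> (\<forall>x. x \<noteq> z \<longrightarrow> e \<le> x) \<and>
    (\<forall>a b. \<not> a \<le> b \<longrightarrow> (\<exists>c d. c * a * d \<noteq> z \<and> c * b * d = z))"
proof -
  define syn :: "'a \<Rightarrow> 'a rel"
    where "syn x = {(a, b). \<forall>c d. c * a * d \<le> x \<longleftrightarrow> c * b * d \<le> x}" for x
  \<comment> \<open>For all \<open>c\<close> and \<open>d\<close>, the elements
    \<open>c * a * d\<close> and \<open>c * b * d\<close> have the same upper bounds and so
    coincide, against \<open>sep\<close>.\<close>
  have "a = b" if "\<And>x. (a, b) \<in> syn x" for a b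
  proof (rule ccontr)
    assume "a \<noteq> b"
    with sep obtain c d where "c * a * d \<noteq> c * b * d" by blast
    moreover have "c * a * d \<le> x \<longleftrightarrow> c * b * d \<le> x" for x
      using that[of x] unfolding syn_def by blast
    ultimately show False using antisym by blast
  qed
  then obtain z where z: "syn z = Id"
    using subdirectly_irreducible_family[OF si, of syn] congruence_syntactic
    unfolding syn_def by blast
  \<comment> \<open>Down-sets absorb multiplication, so every context sends \<open>a\<close> and
    \<open>z\<close> below \<open>z\<close>; the congruence \<open>syn z\<close> cannot distinguish
    them.\<close>
  have "a = z" if "a \<le> z" for a
  proof -
    have "c * b * d \<le> z" if "b \<le> z" for b c d
      using that mult_le_left mult_le_right order_trans by metis
    with that have "(a, z) \<in> syn z" unfolding syn_def by auto
    with z show ?thesis by auto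
  qed
  note minimal = this
  have zero: "is_zero z"
    using minimal by (rule is_zero_if_minimal)
  have le_z: "a \<le> z \<longleftrightarrow> a = z" for a
    using minimal by blast
  have z_le: "z \<le> a" for a
    using zero by (simp add: is_zero_def less_eq_iff_add add.commute)
  have sep_z: "\<exists>c d. (c * a * d = z) \<noteq> (c * b * d = z)" if "a \<noteq> b" for a b
  proof -
    have "(a, b) \<notin> syn z" using z that by simp
    then show ?thesis unfolding syn_def le_z by auto
  qed
  have least: "\<exists>e. e \<noteq> z \<and> (\<forall>x. x \<noteq> z \<longrightarrow> e \<le> x)"
  proof -
    obtain a b :: 'a where "a \<noteq> b"
      and ab: "\<And>R. congruence (+) (*) R \<Longrightarrow> R \<noteq> Id \<Longrightarrow> (a, b) \<in> R"
      using si unfolding subdirectly_irreducible_iff by blast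
    obtain c d where cd: "(c * a * d = z) \<noteq> (c * b * d = z)"
      using sep_z[OF \<open>a \<noteq> b\<close>] by blast
    \<comment> \<open>Equality after adding \<open>x\<close> relates \<open>z\<close> to
      \<open>x\<close>, so it is a non-identity congruence and contains the pair
      \<open>(a, b)\<close>.\<close>
    have eq: "c * a * d + x = c * b * d + x" if "x \<noteq> z" for x
    proof -
      let ?R = "{(a, b). a + x = b + x}"
      have cong: "congruence (+) (*) ?R" by (rule congruence_add_eq)
      have "(z, x) \<in> ?R"
        using z_le[of x] by (simp add: less_eq_iff_add add_idem)
      with \<open>x \<noteq> z\<close> have "?R \<noteq> Id" by auto
      with cong have "(a, b) \<in> ?R" by (rule ab)
      then have "(c * a * d, c * b * d) \<in> ?R"
        by (intro congruence_mul[OF cong] congruence_refl[OF cong])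
      then show ?thesis by simp
    qed
    \<comment> \<open>Exactly one summand is \<open>z\<close>, so \<open>e\<close> is the other one;
      writing the sum avoids a choice. By \<open>eq\<close>, adding it to a non-zero
      \<open>x\<close> has the same effect as adding \<open>z\<close>, so
      \<open>e \<le> x\<close>.\<close>
    define e where "e = c * a * d + c * b * d"
    have "e \<noteq> z"
      unfolding e_def using cd le_z plus_le_iff by metis
    moreover have "e \<le> x" if "x \<noteq> z" for x
    proof (cases "c * a * d = z")
      case True
      with eq[OF that] show ?thesis
        using z_le[of x] z_le[of "c * b * d"] by (simp add: e_def less_eq_iff_add)
    next
      case False
      with cd have "c * b * d = z" by simp
      with eq[OF that] show ?thesis
        using z_le[of x] z_le[of "c * a * d"] by (simp add: e_def less_eq_iff_add add.commute)
    qed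
    ultimately show ?thesis by blast
  qed
  moreover have "\<exists>c d. c * a * d \<noteq> z \<and> c * b * d = z" if "\<not> a \<le> b" for a b
  proof -
    \<comment> \<open>Comparing \<open>a + b\<close> with \<open>b\<close>, rather than
      \<open>a\<close> with \<open>b\<close>, fixes the direction: a context that annihilates the
      sum annihilates \<open>b\<close> as well.\<close>
    from that have "a + b \<noteq> b" by (simp add: less_eq_iff_add)
    then obtain c d where "(c * (a + b) * d = z) \<noteq> (c * b * d = z)"
      using sep_z by blast
    moreover have "c * (a + b) * d = z \<longleftrightarrow> c * a * d = z \<and> c * b * d = z"
      unfolding le_z[symmetric] by (simp add: distrib_left distrib_right plus_le_iff)
    ultimately show ?thesis by blast
  qed
  ultimately show ?thesis using zero by blast
qed

section \<open>Matrix semirings\<close>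

lemma nonempty_sum_related:
  assumes "finite A" "A \<noteq> {}"
    and "\<And>i. i \<in> A \<Longrightarrow> (f i, g i) \<in> R"
    and "\<And>a b c d. (a, b) \<in> R \<Longrightarrow> (c, d) \<in> R \<Longrightarrow> (a + c, b + d) \<in> R"
  shows "(nonempty_sum f A, nonempty_sum g A) \<in> R"
  using assms(1-3)
  by (induction rule: finite_ne_induct)
    (simp_all add: nonempty_sum_singleton nonempty_sum_insert assms(4))

section \<open>Matrix congruences assembled from congruences on the entries\<close>

definition entrywise :: "('n \<Rightarrow> 'n \<Rightarrow> 'a rel) \<Rightarrow> ('a ^ 'n ^ 'n) rel" where
  "entrywise R = {(A, B). \<forall>i j. (A $ i $ j, B $ i $ j) \<in> R i j}"

lemma congruence_entrywise:
  fixes R :: "'n::finite \<Rightarrow> 'n \<Rightarrow> 'a::semiring rel"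
  assumes cong: "\<And>i j. congruence (+) (*) (R i j)"
    and mul: "\<And>i j k a b c d. (a, b) \<in> R i k \<Longrightarrow> (c, d) \<in> R k j \<Longrightarrow> (a * c, b * d) \<in> R i j"
  shows "congruence (+) matrix_mult (entrywise R)"
proof (rule congruenceI)
  fix A B C D
  assume AB: "(A, B) \<in> entrywise R" and CD: "(C, D) \<in> entrywise R"
  have "(A $ i $ k * C $ k $ j, B $ i $ k * D $ k $ j) \<in> R i j" for i j k
    using AB CD by (intro mul[where k = k]) (simp_all add: entrywise_def)
  then have "(nonempty_sum (\<lambda>k. A $ i $ k * C $ k $ j) UNIV,
      nonempty_sum (\<lambda>k. B $ i $ k * D $ k $ j) UNIV) \<in> R i j" for i j
    by (intro nonempty_sum_related congruence_add[OF cong]) simp_all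
  then show "(matrix_mult A C, matrix_mult B D) \<in> entrywise R"
    by (simp add: entrywise_def matrix_mult_def)
qed (auto simp: entrywise_def
      intro: congruence_refl[OF cong] congruence_sym[OF cong] congruence_add[OF cong],
    blast intro: congruence_trans[OF cong])

text \<open>The test matrices are the constant matrix \<open>a\<close> and its modification by
  \<open>b\<close> at one position; a constant background requires no zero in the semiring.\<close>

lemma entrywise_eq_IdD:
  fixes R :: "'n::finite \<Rightarrow> 'n \<Rightarrow> 'a rel"
  assumes "entrywise R = Id" and "\<And>i j a. (a, a) \<in> R i j" and "(a, b) \<in> R i j"
  shows "a = b"
proof -
  let ?B = "\<chi> k l. if k = i \<and> l = j then b else a"
  have "((\<chi> k l. a), ?B) \<in> entrywise R"
    using assms(2,3) by (simp add: entrywise_def)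
  with assms(1) have "(\<chi> k l. a) = ?B" by simp
  then have "(\<chi> k l. a) $ i $ j = ?B $ i $ j" by simp
  then show ?thesis by simp
qed

lemma congruence_Id: "congruence add mul Id"
  by (rule congruenceI) auto

text \<open>Two distinct matrices lie in every non-identity congruence, in particular in those
  lifted from the entries; any position where they differ yields the required pair of
  entries.\<close>

lemma subdirectly_irreducible_if_matrix:
  assumes "subdirectly_irreducible ((+) :: 'a::semiring ^ 'n ^ 'n \<Rightarrow> 'a ^ 'n ^ 'n \<Rightarrow> 'a ^ 'n ^ 'n)
    matrix_mult"
  shows "subdirectly_irreducible ((+) :: 'a \<Rightarrow> 'a \<Rightarrow> 'a) (*)"
proof -
  obtain A B :: "'a ^ 'n ^ 'n" where "A \<noteq> B"
    and AB: "\<And>R. congruence (+) matrix_mult R \<Longrightarrow> R \<noteq> Id \<Longrightarrow> (A, B) \<in> R"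
    using assms unfolding subdirectly_irreducible_iff by blast
  from \<open>A \<noteq> B\<close> obtain i j where "A $ i $ j \<noteq> B $ i $ j"
    by (auto simp: vec_eq_iff)
  moreover have "(A $ i $ j, B $ i $ j) \<in> R" if R: "congruence (+) (*) R" "R \<noteq> Id" for R
  proof -
    have "entrywise (\<lambda>_ _ :: 'n. R) \<noteq> Id"
      using R(2) congruence_refl[OF R(1)] entrywise_eq_IdD[of "\<lambda>_ _ :: 'n. R"] by auto
    moreover have "congruence (+) matrix_mult (entrywise (\<lambda>_ _ :: 'n. R))"
      by (rule congruence_entrywise[OF R(1)]) (rule congruence_mul[OF R(1)])
    ultimately have "(A, B) \<in> entrywise (\<lambda>_ _. R)"
      using AB by blast
    then show ?thesis by (simp add: entrywise_def)
  qed
  ultimately show ?thesis unfolding subdirectly_irreducible_iff by blast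
qed

text \<open>Each position is governed by equality for some \<open>p\<close>, so the entrywise
  congruences intersect in the identity. One of them is then the identity, which forces equality at
  all of its positions.\<close>

lemma subdirectly_irreducible_entrywise_family:
  fixes R :: "'p \<Rightarrow> 'n::finite \<Rightarrow> 'n \<Rightarrow> 'a::semiring rel"
  assumes si: "subdirectly_irreducible
      ((+) :: 'a ^ 'n ^ 'n \<Rightarrow> 'a ^ 'n ^ 'n \<Rightarrow> 'a ^ 'n ^ 'n) matrix_mult"
    and cong: "\<And>p. congruence (+) matrix_mult (entrywise (R p))"
    and refl: "\<And>p i j a. (a, a) \<in> R p i j"
    and Id: "\<And>i j. \<exists>p. R p i j = Id"
  obtains p where "\<And>a b i j. (a, b) \<in> R p i j \<Longrightarrow> a = b"
proof -
  have "A = B" if AB: "\<And>p. (A, B) \<in> entrywise (R p)" for A B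
  proof -
    have "A $ i $ j = B $ i $ j" for i j
    proof -
      obtain p where "R p i j = Id" using Id by blast
      moreover have "(A $ i $ j, B $ i $ j) \<in> R p i j"
        using AB[of p] by (simp add: entrywise_def)
      ultimately show ?thesis by simp
    qed
    then show ?thesis by (simp add: vec_eq_iff)
  qed
  then obtain p where "entrywise (R p) = Id"
    using subdirectly_irreducible_family[OF si, of "\<lambda>p. entrywise (R p)"] cong by blast
  then show thesis
    using that entrywise_eq_IdD[of "R p"] refl by blast
qed

section \<open>Separation of elements from two distinct rows or columns\<close>

lemma exists_other_index:
  assumes "CARD('n::finite) \<ge> 2"
  shows "\<exists>p :: 'n. p \<noteq> i"
proof (rule ccontr)
  assume "\<nexists>p. p \<noteq> i"
  then have "(UNIV :: 'n set) = {i}" by auto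
  then have "CARD('n) = card {i}" by (rule arg_cong)
  with assms show False by simp
qed

lemma left_reductive_if_matrix_subdirectly_irreducible:
  fixes a b :: "'a::semiring"
  assumes card: "CARD('n::finite) \<ge> 2"
    and si: "subdirectly_irreducible ((+) :: 'a ^ 'n ^ 'n \<Rightarrow> 'a ^ 'n ^ 'n \<Rightarrow> 'a ^ 'n ^ 'n)
      matrix_mult"
    and eq: "\<And>c. c * a = c * b"
  shows "a = b"
proof -
  define L :: "'a rel" where "L = {(a, b). \<forall>c. c * a = c * b}"
  have L: "congruence (+) (*) L"
    by (rule congruenceI) (auto simp: L_def distrib_left mult.assoc[symmetric])
  define R :: "'n \<Rightarrow> 'n \<Rightarrow> 'n \<Rightarrow> 'a rel" where "R p i j = (if i = p then L else Id)" for p i j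
  have "congruence (+) matrix_mult (entrywise (R p))" for p
  proof (rule congruence_entrywise)
    show "congruence (+) (*) (R p i j)" for i j
      by (simp add: R_def L congruence_Id)
    show "(a * c, b * d) \<in> R p i j" if "(a, b) \<in> R p i k" "(c, d) \<in> R p k j" for i j k a b c d
    proof (cases "i = p")
      case True
      then have "(a, b) \<in> L" "(c, d) \<in> L"
        using that congruence_refl[OF L] by (auto simp: R_def split: if_splits)
      then show ?thesis
        using congruence_mul[OF L] True by (simp add: R_def)
    next
      \<comment> \<open>Outside row \<open>p\<close> the left factors are equal, and multiplying
        \<open>L\<close>-related elements by the same left factor gives equal products.\<close>
      case False
      with that show ?thesis
        by (auto simp: R_def L_def split: if_splits)
    qed
  qed
  moreover have "(x, x) \<in> R p i j" for p i j x
    using congruence_refl[OF L] by (simp add: R_def)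
  moreover have "\<exists>p. R p i j = Id" for i j
    using exists_other_index[OF card, of i] by (auto simp: R_def)
  ultimately obtain p where "\<And>x y i j. (x, y) \<in> R p i j \<Longrightarrow> x = y"
    using subdirectly_irreducible_entrywise_family[OF si, of R] by blast
  moreover have "(a, b) \<in> R p p p"
    using eq by (simp add: R_def L_def)
  ultimately show ?thesis by blast
qed

text \<open>Dual to the previous argument, with columns in place of rows and right multiplication in
  place of left multiplication.\<close>

lemma right_reductive_if_matrix_subdirectly_irreducible:
  fixes a b :: "'a::semiring"
  assumes card: "CARD('n::finite) \<ge> 2"
    and si: "subdirectly_irreducible ((+) :: 'a ^ 'n ^ 'n \<Rightarrow> 'a ^ 'n ^ 'n \<Rightarrow> 'a ^ 'n ^ 'n)
      matrix_mult"
    and eq: "\<And>c. a * c = b * c"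
  shows "a = b"
proof -
  define K :: "'a rel" where "K = {(a, b). \<forall>c. a * c = b * c}"
  have K: "congruence (+) (*) K"
    by (rule congruenceI) (auto simp: K_def distrib_right mult.assoc)
  define R :: "'n \<Rightarrow> 'n \<Rightarrow> 'n \<Rightarrow> 'a rel" where "R p i j = (if j = p then K else Id)" for p i j
  have "congruence (+) matrix_mult (entrywise (R p))" for p
  proof (rule congruence_entrywise)
    show "congruence (+) (*) (R p i j)" for i j
      by (simp add: R_def K congruence_Id)
    show "(a * c, b * d) \<in> R p i j" if "(a, b) \<in> R p i k" "(c, d) \<in> R p k j" for i j k a b c d
    proof (cases "j = p")
      case True
      then have "(a, b) \<in> K" "(c, d) \<in> K"
        using that congruence_refl[OF K] by (auto simp: R_def split: if_splits)
      then show ?thesis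
        using congruence_mul[OF K] True by (simp add: R_def)
    next
      case False
      with that show ?thesis
        by (auto simp: R_def K_def split: if_splits)
    qed
  qed
  moreover have "(x, x) \<in> R p i j" for p i j x
    using congruence_refl[OF K] by (simp add: R_def)
  moreover have "\<exists>p. R p i j = Id" for i j
    using exists_other_index[OF card, of j] by (auto simp: R_def)
  ultimately obtain p where "\<And>x y i j. (x, y) \<in> R p i j \<Longrightarrow> x = y"
    using subdirectly_irreducible_entrywise_family[OF si, of R] by blast
  moreover have "(a, b) \<in> R p p p"
    using eq by (simp add: R_def K_def)
  ultimately show ?thesis by blast
qed

text \<open>If no \<open>c\<close> and \<open>d\<close> separated \<open>a\<close> from
  \<open>b\<close>, right cancellation would give \<open>c * a = c * b\<close> for all
  \<open>c\<close>, and left cancellation then \<open>a = b\<close>.\<close>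

lemma separating_if_matrix_subdirectly_irreducible:
  fixes a b :: "'a::semiring"
  assumes "CARD('n::finite) \<ge> 2"
    and "subdirectly_irreducible ((+) :: 'a ^ 'n ^ 'n \<Rightarrow> 'a ^ 'n ^ 'n \<Rightarrow> 'a ^ 'n ^ 'n)
      matrix_mult"
    and "a \<noteq> b"
  shows "\<exists>c d. c * a * d \<noteq> c * b * d"
  using left_reductive_if_matrix_subdirectly_irreducible[OF assms(1,2)]
    right_reductive_if_matrix_subdirectly_irreducible[OF assms(1,2)] assms(3)
  by metis

section \<open>Matrix units and subdirect irreducibility of the matrix semiring\<close>

text \<open>A scaled matrix unit. The zero is an explicit argument because a semiring need not have
  one.\<close>

definition single_entry :: "'a \<Rightarrow> 'n \<Rightarrow> 'n \<Rightarrow> 'a \<Rightarrow> 'a ^ 'n ^ 'n" where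
  "single_entry z p q c = (\<chi> i j. if i = p \<and> j = q then c else z)"

lemma nonempty_sum_single:
  assumes "is_zero z" and "finite A" "i \<in> A" and "\<And>k. k \<in> A \<Longrightarrow> k \<noteq> i \<Longrightarrow> f k = z"
  shows "nonempty_sum f A = f i"
proof (cases "A = {i}")
  case True
  then show ?thesis by (simp add: nonempty_sum_singleton)
next
  case False
  define B where "B = A - {i}"
  have B: "finite B" "B \<noteq> {}" "i \<notin> B" "A = insert i B"
    using assms False by (auto simp: B_def)
  \<comment> \<open>The relation ignores its second component, so the lemma on related sums acts as
    induction for the predicate of being \<open>z\<close>.\<close>
  have "(nonempty_sum f B, nonempty_sum (\<lambda>_. z) B) \<in> {(a, b). a = z}"
    using B assms by (intro nonempty_sum_related) (auto simp: is_zero_def)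
  then have "nonempty_sum f B = z" by simp
  with B assms(1) show ?thesis
    by (simp add: nonempty_sum_insert is_zero_def)
qed

lemma single_entry_mult:
  fixes A :: "'a::semiring ^ 'n::finite ^ 'n"
  assumes z: "is_zero z"
  shows "matrix_mult (single_entry z p q c) A = (\<chi> i j. if i = p then c * A $ q $ j else z)"
proof -
  have "nonempty_sum (\<lambda>k. (if i = p \<and> k = q then c else z) * A $ k $ j) UNIV =
      (if i = p then c * A $ q $ j else z)" for i j
    using z nonempty_sum_single[OF z, of UNIV q "\<lambda>k. (if i = p \<and> k = q then c else z) * A $ k $ j"]
    by (auto simp: is_zero_def)
  then show ?thesis by (simp add: matrix_mult_def single_entry_def)
qed

lemma mult_single_entry:
  fixes A :: "'a::semiring ^ 'n::finite ^ 'n"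
  assumes z: "is_zero z"
  shows "matrix_mult A (single_entry z p q d) = (\<chi> i j. if j = q then A $ i $ p * d else z)"
proof -
  have "nonempty_sum (\<lambda>k. A $ i $ k * (if k = p \<and> j = q then d else z)) UNIV =
      (if j = q then A $ i $ p * d else z)" for i j
    using z nonempty_sum_single[OF z, of UNIV p "\<lambda>k. A $ i $ k * (if k = p \<and> j = q then d else z)"]
    by (auto simp: is_zero_def)
  then show ?thesis by (simp add: matrix_mult_def single_entry_def)
qed

lemma matrix_subdirectly_irreducible_if_least_nonzero:
  fixes z e :: "'a::additively_idempotent_semiring"
  assumes z: "is_zero z" and e: "e \<noteq> z" "\<And>x. x \<noteq> z \<Longrightarrow> e \<le> x"
    and sep: "\<And>a b. \<not> a \<le> b \<Longrightarrow> \<exists>c d. c * a * d \<noteq> z \<and> c * b * d = z"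
  shows "subdirectly_irreducible
    ((+) :: 'a ^ 'n::finite ^ 'n \<Rightarrow> 'a ^ 'n ^ 'n \<Rightarrow> 'a ^ 'n ^ 'n) matrix_mult"
proof -
  fix p :: 'n
  let ?S = "single_entry z p p"
  have add_S: "?S x + ?S y = ?S (x + y)" for x y
    using z by (auto simp: single_entry_def vec_eq_iff is_zero_def)
  have reach: "(?S e, ?S z) \<in> R"
    if R: "congruence (+) matrix_mult R" and AB: "(A, B) \<in> R" and ij: "\<not> A $ i $ j \<le> B $ i $ j"
    for R A B i j
  proof -
    obtain c d where cd: "c * A $ i $ j * d \<noteq> z" "c * B $ i $ j * d = z"
      using sep[OF ij] by blast
    \<comment> \<open>The two factors isolate entry \<open>(i, j)\<close>, scale it by
      \<open>c\<close> and \<open>d\<close>, and move it to the diagonal position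
      \<open>p\<close>.\<close>
    let ?f = "\<lambda>X. matrix_mult (matrix_mult (single_entry z p i c) X) (single_entry z j p d)"
    have f: "?f X = ?S (c * X $ i $ j * d)" for X
      using z unfolding single_entry_mult[OF z] mult_single_entry[OF z]
      by (auto simp: single_entry_def vec_eq_iff is_zero_def)
    have "(?f A, ?f B) \<in> R"
      using AB by (intro congruence_mul[OF R] congruence_refl[OF R])
    then have xz: "(?S (c * A $ i $ j * d), ?S z) \<in> R"
      unfolding f cd(2) .
    \<comment> \<open>Since \<open>e\<close> lies below the non-zero entry, adding
      \<open>?S e\<close> leaves the left matrix unchanged and turns the right one into
      \<open>?S e\<close>. Transitivity with \<open>xz\<close> then relates \<open>?S e\<close> to
      \<open>?S z\<close>.\<close>
    from xz have "(?S e + ?S (c * A $ i $ j * d), ?S e + ?S z) \<in> R"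
      by (intro congruence_add[OF R] congruence_refl[OF R])
    moreover have "e + c * A $ i $ j * d = c * A $ i $ j * d" "e + z = e"
      using e(2)[OF cd(1)] z by (simp_all add: less_eq_iff_add is_zero_def)
    ultimately have "(?S (c * A $ i $ j * d), ?S e) \<in> R"
      by (simp add: add_S)
    with xz show ?thesis
      using congruence_sym[OF R] congruence_trans[OF R] by blast
  qed
  have "?S e $ p $ p \<noteq> ?S z $ p $ p"
    using e(1) by (simp add: single_entry_def)
  then have "?S e \<noteq> ?S z" by metis
  moreover have "(?S e, ?S z) \<in> R" if R: "congruence (+) matrix_mult R" "R \<noteq> Id" for R
  proof -
    obtain A B where AB: "(A, B) \<in> R" "A \<noteq> B"
      using R(2) congruence_refl[OF R(1)] by auto
    then obtain i j where "A $ i $ j \<noteq> B $ i $ j"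
      by (auto simp: vec_eq_iff)
    then have "\<not> A $ i $ j \<le> B $ i $ j \<or> \<not> B $ i $ j \<le> A $ i $ j"
      by (auto dest: antisym)
    then show ?thesis
      using reach[OF R(1)] AB(1) congruence_sym[OF R(1)] by blast
  qed
  ultimately show ?thesis unfolding subdirectly_irreducible_iff by blast
qed

theorem theorem4p8:
  assumes "CARD('n::finite) \<ge> 2"
  shows
    "(subdirectly_irreducible
        ((+) :: 'a::almost_integral_semiring ^ 'n ^ 'n \<Rightarrow> 'a ^ 'n ^ 'n \<Rightarrow> 'a ^ 'n ^ 'n)
        matrix_mult
      \<longleftrightarrow>
      subdirectly_irreducible ((+) :: 'a \<Rightarrow> 'a \<Rightarrow> 'a) (*) \<and>
      (\<forall>a b :: 'a. a \<noteq> b \<longrightarrow> (\<exists>c d. c * a * d \<noteq> c * b * d)))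
     \<and>
     (subdirectly_irreducible ((+) :: 'a \<Rightarrow> 'a \<Rightarrow> 'a) (*) \<and>
      (\<forall>a b :: 'a. a \<noteq> b \<longrightarrow> (\<exists>c d. c * a * d \<noteq> c * b * d))
      \<longleftrightarrow>
      (\<exists>z e :: 'a. is_zero z \<and> e \<noteq> z \<and> (\<forall>x. x \<noteq> z \<longrightarrow> e \<le> x) \<and>
         (\<forall>a b. \<not> a \<le> b \<longrightarrow> (\<exists>c d. c * a * d \<noteq> z \<and> c * b * d = z))))"
proof -
  have "\<exists>z e :: 'a. is_zero z \<and> e \<noteq> z \<and> (\<forall>x. x \<noteq> z \<longrightarrow> e \<le> x) \<and>
      (\<forall>a b. \<not> a \<le> b \<longrightarrow> (\<exists>c d. c * a * d \<noteq> z \<and> c * b * d = z))"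
    (is ?iii)
    if "subdirectly_irreducible ((+) :: 'a \<Rightarrow> 'a \<Rightarrow> 'a) (*) \<and>
      (\<forall>a b :: 'a. a \<noteq> b \<longrightarrow> (\<exists>c d. c * a * d \<noteq> c * b * d))" (is ?ii)
    using that by (intro least_nonzero_if_subdirectly_irreducible) blast+
  moreover have "subdirectly_irreducible
      ((+) :: 'a ^ 'n ^ 'n \<Rightarrow> 'a ^ 'n ^ 'n \<Rightarrow> 'a ^ 'n ^ 'n) matrix_mult" (is ?i)
    if ?iii
    using that matrix_subdirectly_irreducible_if_least_nonzero by blast
  moreover have ?ii if ?i
    using subdirectly_irreducible_if_matrix[OF that]
      separating_if_matrix_subdirectly_irreducible[OF assms that] by blast
  ultimately show ?thesis by blast
qed

end
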